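(* Let $n$ be a positive integer and let $\mathcal F$ be an $\mathcal N$-saturated family of subsets of $[n]$. Then $|\mathcal F|\ge\frac{n+6}{4}$.
   Context: The poset $\mathcal N$ has four elements $a,b,c,d$ with $a<c$, $b<c$, $b<d$ and no other comparabilities. A family $\mathcal Q$ of sets (ordered by inclusion) contains an induced copy of $\mathcal N$ if there are distinct sets in $\mathcal Q$ whose inclusion relations are exactly those of $a,b,c,d$ above. A family $\mathcal F$ of subsets of $[n]=\{1,\dots,n\}$ is $\mathcal N$-saturated if $\mathcal F$ contains no induced copy of $\mathcal N$, but for every $S\subseteq[n]$ with $S\notin\mathcal F$, the family $\mathcal F\cup\{S\}$ contains an induced copy of $\mathcal N$. *)

theory Defs
  imports Complex_Main
begin

definition incomparable :: "'a set \<Rightarrow> 'a set \<Rightarrow> bool" where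
  "incomparable X Y \<longleftrightarrow> \<not> X \<subseteq> Y \<and> \<not> Y \<subseteq> X"

definition contains_induced_N :: "'a set set \<Rightarrow> bool" where
  "contains_induced_N Q \<longleftrightarrow>
     (\<exists>a\<in>Q. \<exists>b\<in>Q. \<exists>c\<in>Q. \<exists>d\<in>Q.
        distinct [a, b, c, d] \<and>
        a \<subset> c \<and> b \<subset> c \<and> b \<subset> d \<and>
        incomparable a b \<and> incomparable a d \<and> incomparable c d)"

definition N_saturated :: "nat \<Rightarrow> nat set set \<Rightarrow> bool" where
  "N_saturated n F \<longleftrightarrow>
     F \<subseteq> Pow {1..n} \<and> \<not> contains_induced_N F \<and>
     (\<forall>S. S \<subseteq> {1..n} \<longrightarrow> S \<notin> F \<longrightarrow> contains_induced_N (insert S F))"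

end

theory Submission
  imports Defs
begin

text \<open>
  Call (A, B) a critical pair for i if A is maximal in F without i, B is minimal in F with i, and
  B - A = {i}. Saturation gives every maximal A and every minimal B a partner: otherwise A and
  A + i (or B and B - i) would be twins, and a copy of N through the new set could be moved into F.
  An N-free poset is series-parallel, and by induction along the decomposition at most 2(|P| - 1)
  elements i have a critical pair inside a part P. A series node contributes at most one new i. At
  a parallel node with k components, every new i contains or avoids each component entirely, so
  the components become a family of k sets of such i, and the partners turn this into an exchange
  property (for the family or for its complement) that forces at most 2(k - 1) of them. With P = F
  this gives n \<le> 2(|F| - 1).
\<close>

section \<open>Vocabulary: series and parallel splits, modules, critical pairs and their
  labels\<close>

definition series :: "'a set set \<Rightarrow> 'a set set \<Rightarrow> bool" where
  "series L R \<longleftrightarrow> L \<noteq> {} \<and> R \<noteq> {} \<and> (\<forall>l\<in>L. \<forall>r\<in>R. l \<subset> r)"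

definition parallel :: "'a set set \<Rightarrow> 'a set set \<Rightarrow> bool" where
  "parallel L R \<longleftrightarrow> L \<noteq> {} \<and> R \<noteq> {} \<and> (\<forall>l\<in>L. \<forall>r\<in>R. incomparable l r)"

text \<open>This is a module of the poset \<open>F\<close>: no outside element distinguishes the
  members of \<open>P\<close>. All parts of the decomposition are of this kind, and relations to one
  member transfer to the whole part.\<close>

definition autonomous :: "'a set set \<Rightarrow> 'a set set \<Rightarrow> bool" where
  "autonomous F P \<longleftrightarrow> P \<subseteq> F \<and>
     (\<forall>x\<in>F - P. (\<forall>p\<in>P. x \<subset> p) \<or> (\<forall>p\<in>P. p \<subset> x) \<or> (\<forall>p\<in>P. incomparable x p))"

text \<open>Maximality and minimality refer to all of \<open>F\<close>, even when pairs inside a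
  part are counted, so \<open>labels F P\<close> is monotone in \<open>P\<close>.\<close>

definition critical :: "'a set set \<Rightarrow> 'a \<Rightarrow> 'a set \<Rightarrow> 'a set \<Rightarrow> bool" where
  "critical F i A B \<longleftrightarrow> A \<in> F \<and> B \<in> F \<and> i \<notin> A \<and> i \<in> B \<and> B \<subseteq> insert i A \<and>
     (\<forall>X\<in>F. A \<subset> X \<longrightarrow> i \<in> X) \<and> (\<forall>X\<in>F. X \<subset> B \<longrightarrow> i \<notin> X)"

definition labels :: "'a set set \<Rightarrow> 'a set set \<Rightarrow> 'a set" where
  "labels F P = {i. \<exists>A\<in>P. \<exists>B\<in>P. critical F i A B}"

lemma incomparable_sym: "incomparable x y \<longleftrightarrow> incomparable y x"
  by (auto simp: incomparable_def)

lemma contains_induced_N_I: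
  assumes "a \<in> F" "b \<in> F" "c \<in> F" "d \<in> F" "a \<subset> c" "b \<subset> c" "b \<subset> d"
    "incomparable a b" "incomparable a d" "incomparable c d"
  shows "contains_induced_N F"
proof -
  have "distinct [a, b, c, d]"
    using assms(5-) unfolding incomparable_def by auto
  then show ?thesis
    unfolding contains_induced_N_def using assms by blast
qed

lemma contains_induced_N_mono:
  "contains_induced_N P \<Longrightarrow> P \<subseteq> F \<Longrightarrow> contains_induced_N F"
  unfolding contains_induced_N_def by blast

section \<open>Series-parallel decomposition\<close>

text \<open>Induction by deleting a minimal element \<open>x\<close>: a split of the rest is
  repaired to take \<open>x\<close> back in. \<open>U\<close> holds the elements above
  \<open>x\<close>; those in \<open>V\<close> are incomparable to \<open>x\<close> by minimality.
  Wherever the repair fails, a copy of N appears.\<close>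

lemma N_free_series_or_parallel:
  assumes "finite P" "\<not> contains_induced_N P" "card P \<ge> 2"
  shows "\<exists>L R. P = L \<union> R \<and> (series L R \<or> parallel L R)"
  using assms
proof (induction "card P" arbitrary: P rule: less_induct)
  case less
  have "P \<noteq> {}" using less.prems by auto
  then obtain x where x: "x \<in> P" "\<And>y. y \<in> P \<Longrightarrow> \<not> y \<subset> x"
    using finite_has_minimal[OF less.prems(1)] by blast
  define Q where "Q = P - {x}"
  have P: "P = insert x Q" "x \<notin> Q" using x by (auto simp: Q_def)
  have finQ: "finite Q" using less.prems by (simp add: Q_def)
  have cQ: "card P = Suc (card Q)" using P finQ by simp
  then have Qne: "Q \<noteq> {}" using less.prems(3) by auto
  have inc: "incomparable x v" if "v \<in> Q" "\<not> x \<subset> v" for v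
    using that x(2)[of v] P unfolding incomparable_def by auto
  have QfreeN: "\<not> contains_induced_N Q"
    using less.prems(2) contains_induced_N_mono[of Q P] P(1) by blast
  define U where "U = {u \<in> Q. x \<subset> u}"
  define V where "V = {u \<in> Q. \<not> x \<subset> u}"
  have QUV: "Q = U \<union> V" by (auto simp: U_def V_def)
  show ?case
  proof (cases "U = {} \<or> V = {}")
    case True
    then show ?thesis
    proof
      assume "U = {}"
      then have "parallel {x} Q"
        using Qne inc unfolding parallel_def U_def by blast
      then show ?thesis using P by (metis insert_is_Un)
    next
      assume "V = {}"
      then have "series {x} Q"
        using Qne unfolding series_def V_def by blast
      then show ?thesis using P by (metis insert_is_Un)
    qed
  next
    case False
    then have ne: "U \<noteq> {}" "V \<noteq> {}" by auto
    then have "card Q \<ge> 2"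
    proof -
      have "U \<inter> V = {}" by (auto simp: U_def V_def)
      then have "card Q = card U + card V"
        using QUV finQ by (metis card_Un_disjoint finite_Un)
      moreover have "card U > 0" "card V > 0"
        using ne finQ QUV by (auto simp: card_gt_0_iff)
      ultimately show ?thesis by linarith
    qed
    then obtain L R where LR: "Q = L \<union> R" "series L R \<or> parallel L R"
      using less.hyps[of Q] cQ finQ QfreeN by auto
    from LR(2) show ?thesis
    proof
      assume s: "series L R"
      show ?thesis
      proof (cases "\<exists>l\<in>L. x \<subset> l")
        case True
        then have "series (insert x L) R"
          using s unfolding series_def by blast
        then show ?thesis using P LR(1) by (metis Un_insert_left)
      next
        case False
        then obtain l where l: "l \<in> L" "l \<in> Q" "\<not> x \<subset> l"
          using s LR(1) unfolding series_def by blast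
        \<comment> \<open>With no member of \<open>L\<close> above \<open>x\<close>, the poset is
          split anew: \<open>x\<close> and all of \<open>V\<close> go below
          \<open>U\<close>.\<close>
        have UR: "U \<subseteq> R" using False LR(1) by (auto simp: U_def)
        have "v \<subset> u" if v: "v \<in> V" and u: "u \<in> U" for u v
        proof (cases "v \<in> L")
          case True then show ?thesis using s UR u unfolding series_def by blast
        next
          case False
          then have vR: "v \<in> R" using v LR(1) by (auto simp: V_def)
          have lv: "l \<subset> v" "l \<subset> u" using vR u UR l s unfolding series_def by blast+
          have xu: "x \<subset> u" "\<not> x \<subset> v" "v \<in> Q" "u \<in> Q" using u v by (auto simp: U_def V_def)
          have "\<not> incomparable u v"
          proof
            \<comment> \<open>The copy of N: \<open>x\<close> and \<open>l\<close> lie below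
              \<open>u\<close>, and \<open>l\<close> also lies below \<open>v\<close>.\<close>
            assume "incomparable u v"
            then have "contains_induced_N P"
              using contains_induced_N_I[of x P l u v] P xu l lv inc[of l] inc[of v]
              by blast
            then show False using less.prems by blast
          qed
          then show ?thesis using xu unfolding incomparable_def by blast
        qed
        then have "series (insert x V) U"
          using ne unfolding series_def U_def by blast
        then show ?thesis using P QUV by (metis Un_insert_left sup_commute)
      qed
    next
      assume p: "parallel L R"
      \<comment> \<open>If all three fail, some \<open>u\<close> above \<open>x\<close> is
        comparable to some \<open>v\<close> that is not, and \<open>x\<close> has elements above it
        in both \<open>L\<close> and \<open>R\<close>.\<close>
      have "parallel (insert x U) V \<or> parallel L (insert x R) \<or> parallel (insert x L) R"
      proof (rule ccontr)
        assume neg: "\<not> ?thesis"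
        obtain u v where uv: "u \<in> U" "v \<in> V" "\<not> incomparable u v"
          using neg ne inc unfolding parallel_def V_def by blast
        have xu: "x \<subset> u" "\<not> x \<subset> v" "v \<in> Q" "u \<in> Q" using uv by (auto simp: U_def V_def)
        then have vu: "v \<subset> u" using uv(3) unfolding incomparable_def by blast
        have "parallel (insert x L) R" if "\<forall>r\<in>R. \<not> x \<subset> r"
          using that p inc LR(1) unfolding parallel_def by blast
        then obtain r where r: "r \<in> R" "x \<subset> r" using neg by blast
        have "parallel L (insert x R)" if "\<forall>l\<in>L. \<not> x \<subset> l"
          using that p inc LR(1) unfolding parallel_def by (auto simp: incomparable_sym[of _ x])
        then obtain l where l: "l \<in> L" "x \<subset> l" using neg by blast
        \<comment> \<open>Being comparable, \<open>u\<close> and \<open>v\<close> lie on the same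
          side of the split; \<open>w\<close> is an element above \<open>x\<close> on the other
          side. Then \<open>v\<close>, \<open>x\<close> below \<open>u\<close>, together with
          \<open>x\<close> below \<open>w\<close>, form N.\<close>
        have "\<exists>w\<in>Q. x \<subset> w \<and> incomparable v w \<and> incomparable u w"
        proof (cases "u \<in> L")
          case True
          then have "v \<in> L" using p LR(1) xu uv(3) unfolding parallel_def by blast
          then show ?thesis using True r LR(1) p unfolding parallel_def by blast
        next
          case False
          then have "u \<in> R" using LR(1) xu by blast
          then have "v \<in> R"
            using p LR(1) xu uv(3) incomparable_sym[of u v] unfolding parallel_def by blast
          then have "incomparable l v" "incomparable l u"
            using \<open>u \<in> R\<close> l p unfolding parallel_def by blast+
          then show ?thesis using l LR(1) incomparable_sym[of l] by blast
        qed
        then obtain w where "w \<in> Q" "x \<subset> w" "incomparable v w" "incomparable u w" by blast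
        then have "contains_induced_N P"
          using contains_induced_N_I[of v P x u w] P xu vu inc[of v] incomparable_sym by blast
        then show False using less.prems by blast
      qed
      then show ?thesis using P LR(1) QUV
        by (metis Un_insert_left Un_insert_right)
    qed
  qed
qed

text \<open>Parallel splits are iterated until every part is a singleton or a series composition.
  Such parts are connected, so they are the components of the comparability graph.\<close>

lemma N_free_components:
  assumes "finite P" "\<not> contains_induced_N P" "P \<noteq> {}"
  shows "\<exists>\<Z>. \<Union>\<Z> = P \<and> (\<forall>Z\<in>\<Z>. card Z = 1 \<or> (\<exists>L R. Z = L \<union> R \<and> series L R)) \<and>
    (\<forall>Y\<in>\<Z>. \<forall>Z\<in>\<Z>. Y \<noteq> Z \<longrightarrow> parallel Y Z)"
  using assms
proof (induction "card P" arbitrary: P rule: less_induct)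
  case less
  show ?case
  proof (cases "card P = 1 \<or> (\<exists>L R. P = L \<union> R \<and> series L R)")
    case True
    then show ?thesis by (intro exI[of _ "{P}"]) simp
  next
    case False
    then have "card P \<ge> 2" using less.prems
      by (metis One_nat_def Suc_leI card_gt_0_iff le_neq_implies_less numeral_2_eq_2)
    then obtain L R where LR: "P = L \<union> R" "parallel L R"
      using N_free_series_or_parallel[OF less.prems(1,2)] False by blast
    have disj: "L \<inter> R = {}" using LR unfolding parallel_def incomparable_def by blast
    have ne: "L \<noteq> {}" "R \<noteq> {}" using LR unfolding parallel_def by auto
    have "L \<subset> P" "R \<subset> P" using disj ne LR by auto
    then have card: "card L < card P" "card R < card P"
      using less.prems(1) psubset_card_mono by metis+
    have fin: "finite L" "finite R" using LR less.prems by auto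
    have free: "\<not> contains_induced_N L" "\<not> contains_induced_N R"
      using less.prems(2) contains_induced_N_mono LR(1) by blast+
    obtain X where X: "\<Union>X = L" "\<forall>Z\<in>X. card Z = 1 \<or> (\<exists>L R. Z = L \<union> R \<and> series L R)"
      "\<forall>Y\<in>X. \<forall>Z\<in>X. Y \<noteq> Z \<longrightarrow> parallel Y Z"
      using less.hyps[OF card(1) fin(1) free(1) ne(1)] by blast
    obtain Y where Y: "\<Union>Y = R" "\<forall>Z\<in>Y. card Z = 1 \<or> (\<exists>L R. Z = L \<union> R \<and> series L R)"
      "\<forall>X\<in>Y. \<forall>Z\<in>Y. X \<noteq> Z \<longrightarrow> parallel X Z"
      using less.hyps[OF card(2) fin(2) free(2) ne(2)] by blast
    have nonempty: "Z \<noteq> {}" if "Z \<in> X \<union> Y" for Z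
      using that X(2) Y(2) unfolding series_def by fastforce
    have xy: "parallel Z W \<and> parallel W Z" if "Z \<in> X" "W \<in> Y" for Z W
    proof -
      have "Z \<subseteq> L" "W \<subseteq> R" using that X(1) Y(1) by auto
      then have "\<forall>z\<in>Z. \<forall>w\<in>W. incomparable z w" using LR(2) unfolding parallel_def by blast
      moreover have "Z \<noteq> {}" "W \<noteq> {}" using nonempty that by auto
      ultimately show ?thesis unfolding parallel_def by (auto simp: incomparable_def)
    qed
    have "\<Union>(X \<union> Y) = P" using X(1) Y(1) LR(1) by auto
    moreover have "\<forall>Z\<in>X \<union> Y. card Z = 1 \<or> (\<exists>L R. Z = L \<union> R \<and> series L R)"
      using X(2) Y(2) by (metis Un_iff)
    moreover have "\<forall>Z\<in>X \<union> Y. \<forall>W\<in>X \<union> Y. Z \<noteq> W \<longrightarrow> parallel Z W"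
      using X(3) Y(3) xy by (metis Un_iff)
    ultimately show ?thesis by blast
  qed
qed

section \<open>Critical pairs\<close>

text \<open>The poset N has no two comparable elements with the same relations to the other two.\<close>

lemma contains_induced_N_replace_twin:
  assumes "contains_induced_N (insert S F)" "A \<in> F" "S \<notin> F" "A \<subset> S \<or> S \<subset> A"
    and tw: "\<And>X. X \<in> F \<Longrightarrow> X \<noteq> A \<Longrightarrow> (X \<subseteq> S \<longleftrightarrow> X \<subseteq> A) \<and> (S \<subseteq> X \<longleftrightarrow> A \<subseteq> X)"
  shows "contains_induced_N F"
proof -
  define N where "N a b c d \<longleftrightarrow> a \<subset> c \<and> b \<subset> c \<and> b \<subset> d \<and>
    incomparable a b \<and> incomparable a d \<and> incomparable c d" for a b c d :: "'a set"
  have NI: "contains_induced_N F" if "a \<in> F" "b \<in> F" "c \<in> F" "d \<in> F" "N a b c d" for a b c d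
    using contains_induced_N_I that unfolding N_def by blast
  obtain a b c d where mem: "a \<in> insert S F" "b \<in> insert S F" "c \<in> insert S F" "d \<in> insert S F"
    and dist: "distinct [a, b, c, d]" and abcd: "N a b c d"
    using assms(1) unfolding contains_induced_N_def N_def by blast
  consider "a \<in> F" "b \<in> F" "c \<in> F" "d \<in> F" | "a = S" "b \<in> F" "c \<in> F" "d \<in> F"
    | "a \<in> F" "b = S" "c \<in> F" "d \<in> F" | "a \<in> F" "b \<in> F" "c = S" "d \<in> F"
    | "a \<in> F" "b \<in> F" "c \<in> F" "d = S"
    using mem dist by auto
  then show ?thesis
  proof cases
    case 1 then show ?thesis using NI abcd by blast
  next
    case 2
    \<comment> \<open>If \<open>A\<close> stood beside \<open>S\<close> in the copy, two comparable
      members of N would have the same relations to the other two.\<close>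
    have "b \<noteq> A \<and> c \<noteq> A \<and> d \<noteq> A"
      using abcd assms(4) 2 tw[of b] tw[of c] tw[of d] unfolding N_def incomparable_def by auto
    then have "N A b c d"
      using abcd 2 tw[of b] tw[of c] tw[of d] unfolding N_def incomparable_def by blast
    then show ?thesis using NI 2 assms(2) by blast
  next
    case 3
    have "a \<noteq> A \<and> c \<noteq> A \<and> d \<noteq> A"
      using abcd assms(4) 3 tw[of a] tw[of c] tw[of d] unfolding N_def incomparable_def by auto
    then have "N a A c d"
      using abcd 3 tw[of a] tw[of c] tw[of d] unfolding N_def incomparable_def by blast
    then show ?thesis using NI 3 assms(2) by blast
  next
    case 4
    have "a \<noteq> A \<and> b \<noteq> A \<and> d \<noteq> A"
      using abcd assms(4) 4 tw[of a] tw[of b] tw[of d] unfolding N_def incomparable_def by auto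
    then have "N a b A d"
      using abcd 4 tw[of a] tw[of b] tw[of d] unfolding N_def incomparable_def by blast
    then show ?thesis using NI 4 assms(2) by blast
  next
    case 5
    have "a \<noteq> A \<and> b \<noteq> A \<and> c \<noteq> A"
      using abcd assms(4) 5 tw[of a] tw[of b] tw[of c] unfolding N_def incomparable_def by auto
    then have "N a b c A"
      using abcd 5 tw[of a] tw[of b] tw[of c] unfolding N_def incomparable_def by blast
    then show ?thesis using NI 5 assms(2) by blast
  qed
qed

lemma N_saturated_finite: "N_saturated n F \<Longrightarrow> finite F"
  unfolding N_saturated_def by (meson finite_Pow_iff finite_atLeastAtMost finite_subset)

text \<open>Saturation is applied to the set \<open>insert i A\<close>; the partner is then a
  minimal member of \<open>F\<close> that contains \<open>i\<close> and lies inside this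
  set.\<close>

lemma critical_partner_of_maximal:
  assumes sat: "N_saturated n F" and i: "i \<in> {1..n}" and A: "A \<in> F" "i \<notin> A"
    and max: "\<And>X. X \<in> F \<Longrightarrow> A \<subset> X \<Longrightarrow> i \<in> X"
  shows "\<exists>B. critical F i A B"
proof -
  have "\<exists>B\<in>F. i \<in> B \<and> B \<subseteq> insert i A"
  proof (rule ccontr)
    assume no: "\<not> ?thesis"
    then have S: "insert i A \<notin> F" by blast
    moreover have "insert i A \<subseteq> {1..n}" using i A sat unfolding N_saturated_def by blast
    ultimately have "contains_induced_N (insert (insert i A) F)"
      using sat unfolding N_saturated_def by blast
    \<comment> \<open>\<open>A\<close> and \<open>insert i A\<close> are twins: a member inside
      \<open>insert i A\<close> avoids \<open>i\<close> by \<open>no\<close>, and a member properly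
      above \<open>A\<close> contains \<open>i\<close> by \<open>max\<close>.\<close>
    then have "contains_induced_N F"
      using contains_induced_N_replace_twin[of "insert i A" F A] A S no max by blast
    then show False using sat unfolding N_saturated_def by blast
  qed
  then have ne: "{B\<in>F. i \<in> B \<and> B \<subseteq> insert i A} \<noteq> {}" by blast
  have fin: "finite {B\<in>F. i \<in> B \<and> B \<subseteq> insert i A}" using N_saturated_finite[OF sat] by simp
  obtain B where "B \<in> {B\<in>F. i \<in> B \<and> B \<subseteq> insert i A}"
    "\<forall>X\<in>{B\<in>F. i \<in> B \<and> B \<subseteq> insert i A}. X \<subseteq> B \<longrightarrow> B = X"
    using finite_has_minimal[OF fin ne] by blast
  \<comment> \<open>Any member of \<open>F\<close> below \<open>B\<close> is still inside
    \<open>insert i A\<close>, so minimality within this collection is minimality in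
    \<open>F\<close>.\<close>
  then have "critical F i A B" unfolding critical_def using A max by blast
  then show ?thesis by blast
qed

text \<open>The order dual of \<open>critical_partner_of_maximal\<close>, with
  \<open>B - {i}\<close> as the new set.\<close>

lemma critical_partner_of_minimal:
  assumes sat: "N_saturated n F" and B: "B \<in> F" "i \<in> B"
    and min: "\<And>X. X \<in> F \<Longrightarrow> X \<subset> B \<Longrightarrow> i \<notin> X"
  shows "\<exists>A. critical F i A B"
proof -
  have "\<exists>A\<in>F. i \<notin> A \<and> B \<subseteq> insert i A"
  proof (rule ccontr)
    assume no: "\<not> ?thesis"
    then have S: "B - {i} \<notin> F" by blast
    moreover have "B - {i} \<subseteq> {1..n}" using B sat unfolding N_saturated_def by blast
    ultimately have "contains_induced_N (insert (B - {i}) F)"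
      using sat unfolding N_saturated_def by blast
    then have "contains_induced_N F"
      using contains_induced_N_replace_twin[of "B - {i}" F B] B S no min by blast
    then show False using sat unfolding N_saturated_def by blast
  qed
  then have ne: "{A\<in>F. i \<notin> A \<and> B \<subseteq> insert i A} \<noteq> {}" by blast
  have fin: "finite {A\<in>F. i \<notin> A \<and> B \<subseteq> insert i A}" using N_saturated_finite[OF sat] by simp
  obtain A where "A \<in> {A\<in>F. i \<notin> A \<and> B \<subseteq> insert i A}"
    "\<forall>X\<in>{A\<in>F. i \<notin> A \<and> B \<subseteq> insert i A}. A \<subseteq> X \<longrightarrow> A = X"
    using finite_has_maximal[OF fin ne] by blast
  then have "critical F i A B" unfolding critical_def using B min by blast
  then show ?thesis by blast
qed

lemma critical_label_unique:
  "critical F i A B \<Longrightarrow> j \<in> B \<Longrightarrow> j \<notin> A \<Longrightarrow> j = i"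
  unfolding critical_def by blast

section \<open>Counting\<close>

text \<open>The hypotheses make the edges from y i to x i a forest on V: the cut c i separates the ends of
  the edge i but of no other edge of J'.\<close>

lemma card_separated_edges_le:
  fixes y x :: "'i \<Rightarrow> 'v" and c :: "'i \<Rightarrow> 'v set"
  assumes "finite V" "V \<noteq> {}" "finite J"
    and "\<And>i. i \<in> J \<Longrightarrow> y i \<in> V \<inter> c i \<and> x i \<in> V - c i"
    and "\<And>J'. J' \<subseteq> J \<Longrightarrow> J' \<noteq> {} \<Longrightarrow> \<exists>i\<in>J'. \<forall>j\<in>J' - {i}. y j \<in> c i \<longleftrightarrow> x j \<in> c i"
  shows "card J + 1 \<le> card V"
  using assms
proof (induction "card V" arbitrary: V J rule: less_induct)
  case less
  show ?case
  proof (cases "J = {}")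
    case True
    then show ?thesis using less.prems by (simp add: Suc_leI card_gt_0_iff)
  next
    case False
    then obtain i where i: "i \<in> J" "\<forall>j\<in>J - {i}. y j \<in> c i \<longleftrightarrow> x j \<in> c i"
      using less.prems(5)[of J] by blast
    \<comment> \<open>Removing the edge \<open>i\<close> splits the graph: each other edge stays on
      one side of the cut, and induction applies to both sides.\<close>
    define J1 where "J1 = {j \<in> J - {i}. y j \<in> c i}"
    define J2 where "J2 = {j \<in> J - {i}. y j \<notin> c i}"
    have ends: "y i \<in> V \<inter> c i" "x i \<in> V - c i" using less.prems(4) i by auto
    then have "V \<inter> c i \<subset> V" "V - c i \<subset> V" by auto
    then have lt: "card (V \<inter> c i) < card V" "card (V - c i) < card V"
      using less.prems(1) psubset_card_mono by metis+
    have 1: "card J1 + 1 \<le> card (V \<inter> c i)"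
    proof (rule less.hyps[OF lt(1)])
      show "y j \<in> V \<inter> c i \<inter> c j \<and> x j \<in> V \<inter> c i - c j" if "j \<in> J1" for j
        using that i less.prems(4)[of j] unfolding J1_def by auto
      show "\<exists>i\<in>J'. \<forall>j\<in>J' - {i}. y j \<in> c i \<longleftrightarrow> x j \<in> c i" if "J' \<subseteq> J1" "J' \<noteq> {}" for J'
        by (rule less.prems(5)) (use that J1_def in auto)
    qed (use less.prems ends J1_def in auto)
    have 2: "card J2 + 1 \<le> card (V - c i)"
    proof (rule less.hyps[OF lt(2)])
      show "y j \<in> (V - c i) \<inter> c j \<and> x j \<in> V - c i - c j" if "j \<in> J2" for j
        using that i less.prems(4)[of j] unfolding J2_def by auto
      show "\<exists>i\<in>J'. \<forall>j\<in>J' - {i}. y j \<in> c i \<longleftrightarrow> x j \<in> c i" if "J' \<subseteq> J2" "J' \<noteq> {}" for J'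
        by (rule less.prems(5)) (use that J2_def in auto)
    qed (use less.prems ends J2_def in auto)
    have "J = insert i (J1 \<union> J2)" using i by (auto simp: J1_def J2_def)
    then have "card J \<le> Suc (card (J1 \<union> J2))" by (simp add: card_insert_le_m1)
    also have "\<dots> \<le> Suc (card J1 + card J2)" using card_Un_le by auto
    finally have "card J \<le> Suc (card J1 + card J2)" .
    moreover have "card V = card (V \<inter> c i) + card (V - c i)"
      using less.prems(1) by (metis card_Int_Diff)
    ultimately show ?thesis using 1 2 by linarith
  qed
qed

text \<open>Each \<open>i\<close> gives an edge from \<open>y i\<close>, a member whose set is
  largest among those containing \<open>i\<close>, to an exchange partner \<open>x i\<close>. These
  edges are covered by two forests on \<open>V\<close>, which explains the factor 2.\<close>

lemma card_exchange_family_le: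
  fixes D :: "'z \<Rightarrow> nat set"
  assumes V: "finite V" "V \<noteq> {}" and J: "finite J"
    and D: "\<And>Z. Z \<in> V \<Longrightarrow> D Z \<subseteq> J"
    and cover: "\<And>i. i \<in> J \<Longrightarrow> \<exists>Z\<in>V. i \<in> D Z"
    and exch: "\<And>Y i. Y \<in> V \<Longrightarrow> i \<in> D Y \<Longrightarrow> \<exists>X\<in>V. i \<notin> D X \<and> D Y - {i} \<subseteq> D X"
  shows "card J + 2 \<le> 2 * card V"
proof -
  have finD: "finite (D Z)" if "Z \<in> V" for Z using D[OF that] J finite_subset by blast
  have "\<exists>Y. Y \<in> V \<and> i \<in> D Y \<and> (\<forall>Z\<in>V. i \<in> D Z \<longrightarrow> card (D Z) \<le> card (D Y))" if "i \<in> J" for i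
  proof -
    have f: "finite ((\<lambda>Z. card (D Z)) ` {Z\<in>V. i \<in> D Z})" using V by simp
    have ne: "(\<lambda>Z. card (D Z)) ` {Z\<in>V. i \<in> D Z} \<noteq> {}" using cover[OF that] by blast
    obtain Y where "Y \<in> {Z\<in>V. i \<in> D Z}" "card (D Y) = Max ((\<lambda>Z. card (D Z)) ` {Z\<in>V. i \<in> D Z})"
      using Max_in[OF f ne] by (metis (no_types, lifting) imageE)
    then show ?thesis using Max_ge[OF f] by auto
  qed
  then obtain y where y: "\<And>i. i \<in> J \<Longrightarrow> y i \<in> V \<and> i \<in> D (y i)"
    "\<And>i Z. i \<in> J \<Longrightarrow> Z \<in> V \<Longrightarrow> i \<in> D Z \<Longrightarrow> card (D Z) \<le> card (D (y i))" by metis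
  have "\<forall>i\<in>J. \<exists>X. X \<in> V \<and> i \<notin> D X \<and> D (y i) - {i} \<subseteq> D X"
    using exch y(1) by blast
  from bchoice[OF this]
  obtain x where "\<forall>i\<in>J. x i \<in> V \<and> i \<notin> D (x i) \<and> D (y i) - {i} \<subseteq> D (x i)" ..
  then have x: "x i \<in> V \<and> i \<notin> D (x i) \<and> D (y i) - {i} \<subseteq> D (x i)" if "i \<in> J" for i
    using that by blast
  define c where "c i = {Z. i \<in> D Z}" for i
  have key: "card (D (y j)) < card (D (y i)) \<or>
      card (D (y j)) = card (D (y i)) \<and> D (x j) - D (y j) = {i}"
    if "i \<in> J" "j \<in> J" "j \<noteq> i" "\<not> (y j \<in> c i \<longleftrightarrow> x j \<in> c i)" for i j
  proof -
    \<comment> \<open>The exchange at \<open>j\<close> loses only \<open>j\<close>, so the edge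
      \<open>j\<close> can cross the cut of \<open>i\<close> only by gaining
      \<open>i\<close>.\<close>
    have i: "i \<in> D (x j)" "i \<notin> D (y j)" using that x[of j] unfolding c_def by auto
    have fin: "finite (D (x j))" "finite (D (y j))" using finD x y that by auto
    have "D (x j) = (D (y j) - {j}) \<union> (D (x j) - D (y j))" using x[of j] that by auto
    moreover have "card ((D (y j) - {j}) \<union> (D (x j) - D (y j)))
        = card (D (y j) - {j}) + card (D (x j) - D (y j))"
      using fin by (intro card_Un_disjoint) auto
    ultimately have s: "card (D (x j)) = card (D (y j) - {j}) + card (D (x j) - D (y j))" by simp
    have "Suc (card (D (y j) - {j})) = card (D (y j))"
      using y(1)[of j] that fin by (metis card_Suc_Diff1)
    \<comment> \<open>Since \<open>x j\<close> contains \<open>i\<close>, it competed in the choice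
      of \<open>y i\<close>.\<close>
    moreover have le: "card (D (x j)) \<le> card (D (y i))" using y(2)[of i "x j"] x[of j] that i by blast
    moreover have p: "card (D (x j) - D (y j)) \<ge> 1"
      using i fin by (metis DiffI One_nat_def Suc_leI card_gt_0_iff empty_iff finite_Diff)
    \<comment> \<open>The exchange loses one element and gains at least one, so the size does not
      drop; equality with the size at \<open>y i\<close> forces a gain of exactly one.\<close>
    ultimately consider "card (D (y j)) < card (D (y i))"
      | "card (D (y j)) = card (D (y i))" "card (D (x j) - D (y j)) = 1"
      using s by linarith
    then show ?thesis
    proof cases
      case 2
      then obtain k where "D (x j) - D (y j) = {k}" by (auto simp: card_1_singleton_iff)
      then show ?thesis using 2 i by auto
    qed simp
  qed
  txt \<open>By the choice of y i of maximal size, the cut of i can only separate an edge j with smaller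
    D (y j), or of the same size if i is the single element exchanged for j. Ordering the
    labels by size and then by value (or reversed value) removes the second obstruction on
    J1 (or J2).\<close>
  define J1 where "J1 = {j\<in>J. \<forall>i. D (x j) - D (y j) = {i} \<longrightarrow> j < i}"
  define J2 where "J2 = {j\<in>J. \<forall>i. D (x j) - D (y j) = {i} \<longrightarrow> i < j}"
  have "J = J1 \<union> J2"
  proof -
    have "j \<in> J1 \<union> J2" if "j \<in> J" for j
    proof (cases "\<exists>i. D (x j) - D (y j) = {i}")
      case True
      then obtain i where i: "D (x j) - D (y j) = {i}" by blast
      \<comment> \<open>The gained element is not \<open>j\<close>, because \<open>j\<close> is
        missing from \<open>D (x j)\<close>; hence it is strictly larger or strictly
        smaller.\<close>
      then have "i \<noteq> j" using x[OF that] by blast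
      then show ?thesis using i that unfolding J1_def J2_def by auto
    qed (use that in \<open>auto simp: J1_def J2_def\<close>)
    then show ?thesis unfolding J1_def J2_def by blast
  qed
  then have cJ: "card J \<le> card J1 + card J2" by (metis card_Un_le)
  have least: "\<exists>i\<in>J'. \<forall>j\<in>J'. card (D (y i)) < card (D (y j)) \<or>
      card (D (y i)) = card (D (y j)) \<and> g i \<le> g j" if J': "J' \<noteq> {}" for J' and g :: "nat \<Rightarrow> nat"
  proof -
    obtain k where k: "k \<in> J'" using J' by blast
    have "\<exists>i. i \<in> J' \<and> (\<forall>j. j \<in> J' \<longrightarrow> card (D (y i)) \<le> card (D (y j)))"
      using ex_has_least_nat[of "\<lambda>i. i \<in> J'" k "\<lambda>i. card (D (y i))"] k by blast
    then obtain m where m: "m \<in> J'" "\<And>j. j \<in> J' \<Longrightarrow> card (D (y m)) \<le> card (D (y j))" by blast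
    obtain i where "i \<in> J'" "card (D (y i)) = card (D (y m))"
      "\<And>j. j \<in> J' \<Longrightarrow> card (D (y j)) = card (D (y m)) \<Longrightarrow> g i \<le> g j"
      using ex_has_least_nat[of "\<lambda>i. i \<in> J' \<and> card (D (y i)) = card (D (y m))" m g] m(1) by blast
    then show ?thesis using m(2) by (metis le_neq_implies_less)
  qed
  have 1: "card J1 + 1 \<le> card V"
  proof (rule card_separated_edges_le[of V J1 y c x])
    fix J' assume J': "J' \<subseteq> J1" "J' \<noteq> {}"
    obtain i where i: "i \<in> J'" "\<And>j. j \<in> J' \<Longrightarrow> card (D (y i)) < card (D (y j)) \<or>
      card (D (y i)) = card (D (y j)) \<and> i \<le> j" using least[OF J'(2), of "\<lambda>i. i"] by blast
    have "y j \<in> c i \<longleftrightarrow> x j \<in> c i" if j: "j \<in> J' - {i}" for j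
    proof (rule ccontr)
      assume "\<not> ?thesis"
      moreover have "i \<in> J" "j \<in> J1" "j \<in> J" using i j J' unfolding J1_def by auto
      ultimately show False using key[of i j] i(2)[of j] j unfolding J1_def by force
    qed
    then show "\<exists>i\<in>J'. \<forall>j\<in>J' - {i}. y j \<in> c i \<longleftrightarrow> x j \<in> c i" using i by blast
  qed (use V J y x in \<open>auto simp: J1_def c_def\<close>)
  have 2: "card J2 + 1 \<le> card V"
  proof (rule card_separated_edges_le[of V J2 y c x])
    fix J' assume J': "J' \<subseteq> J2" "J' \<noteq> {}"
    \<comment> \<open>Reversal by \<open>Max J - i\<close> uses truncated subtraction; this bound
      keeps it strictly decreasing on the labels.\<close>
    have bd: "j \<le> Max J" if "j \<in> J'" for j using that J' J unfolding J2_def by auto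
    obtain i where i: "i \<in> J'" "\<And>j. j \<in> J' \<Longrightarrow> card (D (y i)) < card (D (y j)) \<or>
      card (D (y i)) = card (D (y j)) \<and> Max J - i \<le> Max J - j"
      using least[OF J'(2), of "\<lambda>i. Max J - i"] by blast
    have "y j \<in> c i \<longleftrightarrow> x j \<in> c i" if j: "j \<in> J' - {i}" for j
    proof (rule ccontr)
      assume neg: "\<not> ?thesis"
      have mem: "i \<in> J" "j \<in> J2" "j \<in> J" "j \<in> J'" "j \<noteq> i" using i(1) j J' unfolding J2_def by auto
      have *: "card (D (y j)) = card (D (y i))" "D (x j) - D (y j) = {i}"
        using key[OF mem(1,3,5) neg] i(2)[OF mem(4)] by linarith+
      then have "i < j" using mem(2) unfolding J2_def by blast
      moreover have "Max J - i \<le> Max J - j" using *(1) i(2)[OF mem(4)] by linarith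
      ultimately show False using bd[OF mem(4)] by linarith
    qed
    then show "\<exists>i\<in>J'. \<forall>j\<in>J' - {i}. y j \<in> c i \<longleftrightarrow> x j \<in> c i" using i by blast
  qed (use V J y x in \<open>auto simp: J2_def c_def\<close>)
  show ?thesis using cJ 1 2 by linarith
qed

section \<open>Labels inside autonomous sets\<close>

text \<open>Being anchored rules out that, at a parallel node P, some maximal element and some minimal
  element of P both have their partners outside P.\<close>

definition anchored :: "'a set set \<Rightarrow> 'a set set \<Rightarrow> bool" where
  "anchored F P \<longleftrightarrow> (\<forall>x\<in>F. \<forall>y\<in>F. (\<forall>p\<in>P. incomparable x p \<and> incomparable y p) \<longrightarrow>
     (\<exists>z\<in>F. ((\<forall>p\<in>P. z \<subset> p) \<or> (\<forall>p\<in>P. p \<subset> z)) \<and> incomparable z x \<and> incomparable z y))"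

lemma autonomousD:
  assumes "autonomous F P" "x \<in> F" "x \<notin> P" "p \<in> P"
  shows "x \<subset> p \<Longrightarrow> q \<in> P \<Longrightarrow> x \<subset> q" "p \<subset> x \<Longrightarrow> q \<in> P \<Longrightarrow> q \<subset> x"
    "incomparable x p \<Longrightarrow> q \<in> P \<Longrightarrow> incomparable x q"
proof -
  have *: "(\<forall>p\<in>P. x \<subset> p) \<or> (\<forall>p\<in>P. p \<subset> x) \<or> (\<forall>p\<in>P. incomparable x p)"
    using assms unfolding autonomous_def by blast
  show "x \<subset> p \<Longrightarrow> q \<in> P \<Longrightarrow> x \<subset> q" "p \<subset> x \<Longrightarrow> q \<in> P \<Longrightarrow> q \<subset> x"
    "incomparable x p \<Longrightarrow> q \<in> P \<Longrightarrow> incomparable x q"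
    using * assms(4) unfolding incomparable_def by blast+
qed

lemma autonomous_series:
  assumes "autonomous F (L \<union> R)" "series L R"
  shows "autonomous F L" "autonomous F R"
proof -
  have *: "x \<in> R \<Longrightarrow> \<forall>p\<in>L. p \<subset> x" "x \<in> L \<Longrightarrow> \<forall>p\<in>R. x \<subset> p" for x
    using assms(2) unfolding series_def by blast+
  have **: "(\<forall>p\<in>L \<union> R. x \<subset> p) \<or> (\<forall>p\<in>L \<union> R. p \<subset> x) \<or> (\<forall>p\<in>L \<union> R. incomparable x p)"
    if "x \<in> F - (L \<union> R)" for x
    using assms(1) that unfolding autonomous_def by blast
  have sub: "L \<subseteq> F" "R \<subseteq> F" using assms(1) unfolding autonomous_def by auto
  have "(\<forall>p\<in>L. x \<subset> p) \<or> (\<forall>p\<in>L. p \<subset> x) \<or> (\<forall>p\<in>L. incomparable x p)" if "x \<in> F - L" for x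
  proof (cases "x \<in> R")
    case True then show ?thesis using *(1) by simp
  next
    case False then show ?thesis using **[of x] that by auto
  qed
  then show "autonomous F L" unfolding autonomous_def using sub by simp
  have "(\<forall>p\<in>R. x \<subset> p) \<or> (\<forall>p\<in>R. p \<subset> x) \<or> (\<forall>p\<in>R. incomparable x p)" if "x \<in> F - R" for x
  proof (cases "x \<in> L")
    case True then show ?thesis using *(2) by simp
  next
    case False then show ?thesis using **[of x] that by auto
  qed
  then show "autonomous F R" unfolding autonomous_def using sub by simp
qed

text \<open>Any \<open>r\<close> in \<open>R\<close> anchors \<open>L\<close>, and any
  \<open>l\<close> in \<open>L\<close> anchors \<open>R\<close>: an element incomparable to one side
  lies outside \<open>L \<union> R\<close>, hence by autonomy is incomparable to the other side
  too.\<close>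

lemma anchored_series:
  assumes "autonomous F (L \<union> R)" "series L R"
  shows "anchored F L" "anchored F R"
proof -
  obtain l r where lr: "l \<in> L" "r \<in> R" using assms(2) unfolding series_def by blast
  have F: "l \<in> F" "r \<in> F" using assms(1) lr unfolding autonomous_def by auto
  have less: "\<forall>p\<in>L. p \<subset> r" "\<forall>p\<in>R. l \<subset> p" using assms(2) lr unfolding series_def by blast+
  have 1: "incomparable r x" if "x \<in> F" "\<forall>p\<in>L. incomparable x p" for x
  proof -
    have "x \<notin> L \<union> R" using that assms(2) lr unfolding series_def incomparable_def by blast
    then show ?thesis
      using autonomousD(3)[OF assms(1), of x l r] that lr incomparable_sym by blast
  qed
  have 2: "incomparable l x" if "x \<in> F" "\<forall>p\<in>R. incomparable x p" for x
  proof -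
    have "x \<notin> L \<union> R" using that assms(2) lr unfolding series_def incomparable_def by blast
    then show ?thesis
      using autonomousD(3)[OF assms(1), of x r l] that lr incomparable_sym by blast
  qed
  show "anchored F L" unfolding anchored_def
    by (intro ballI impI bexI[of _ r] conjI 1 disjI2) (use less F in auto)
  show "anchored F R" unfolding anchored_def
    by (intro ballI impI bexI[of _ l] conjI 2 disjI1) (use less F in auto)
qed

section \<open>Components of a parallel node\<close>

lemma autonomous_component:
  assumes "autonomous F P" "Z \<subseteq> P" "\<And>x z. x \<in> P - Z \<Longrightarrow> z \<in> Z \<Longrightarrow> incomparable x z"
  shows "autonomous F Z"
  unfolding autonomous_def
proof (intro conjI ballI)
  show "Z \<subseteq> F" using assms unfolding autonomous_def by blast
  fix x assume x: "x \<in> F - Z"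
  show "(\<forall>p\<in>Z. x \<subset> p) \<or> (\<forall>p\<in>Z. p \<subset> x) \<or> (\<forall>p\<in>Z. incomparable x p)"
  proof (cases "x \<in> P")
    case True then show ?thesis using assms(3) x by blast
  next
    case False
    then have "x \<in> F - P" using x by blast
    then show ?thesis using assms(1,2) unfolding autonomous_def by blast
  qed
qed

text \<open>Maximality within \<open>P\<close> extends to \<open>F\<close>: an outside set above
  \<open>M\<close> is above all of \<open>P\<close>, in particular above \<open>B\<close>, and so
  contains \<open>i\<close>.\<close>

lemma maximal_without_lift:
  assumes "autonomous F P" "B \<in> P" "i \<in> B" "M \<in> P" "\<And>X. X \<in> P \<Longrightarrow> M \<subset> X \<Longrightarrow> i \<in> X"
    "X \<in> F" "M \<subset> X"
  shows "i \<in> X"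
  using assms autonomousD(2)[OF assms(1,6) _ assms(4,7,2)] by blast

lemma minimal_with_lift:
  assumes "autonomous F P" "A \<in> P" "i \<notin> A" "M \<in> P" "\<And>X. X \<in> P \<Longrightarrow> X \<subset> M \<Longrightarrow> i \<notin> X"
    "X \<in> F" "X \<subset> M"
  shows "i \<notin> X"
  using assms autonomousD(1)[OF assms(1,6) _ assms(4,7,2)] by blast

text \<open>In a mixed \<open>Z\<close>, a maximal member without \<open>i\<close> and a minimal
  member with \<open>i\<close> have partners, both outside \<open>Z\<close> since \<open>i\<close>
  is no label of \<open>Z\<close>. Autonomy of \<open>Z\<close> then forces the first into
  \<open>R\<close> by its partner, and the second out of \<open>R\<close> by the other
  partner.\<close>

lemma series_component_pure:
  assumes sat: "N_saturated n F" and i: "i \<in> {1..n}" and P: "autonomous F P"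
    and Z: "Z \<subseteq> P" "Z = L \<union> R" "series L R"
    and cross: "\<And>x z. x \<in> P - Z \<Longrightarrow> z \<in> Z \<Longrightarrow> incomparable x z"
    and AB: "A \<in> P" "i \<notin> A" "B \<in> P" "i \<in> B" and notin: "i \<notin> labels F Z"
  shows "(\<forall>z\<in>Z. i \<in> z) \<or> (\<forall>z\<in>Z. i \<notin> z)"
proof (rule ccontr)
  assume mixed: "\<not> ?thesis"
  have aZ: "autonomous F Z" by (rule autonomous_component[OF P Z(1) cross])
  have finF: "finite F" using N_saturated_finite[OF sat] .
  have ZF: "Z \<subseteq> F" using aZ unfolding autonomous_def by blast
  have fin: "finite {z\<in>Z. i \<notin> z}" "finite {z\<in>Z. i \<in> z}" using finite_subset[OF ZF finF] by auto
  have ne: "{z\<in>Z. i \<notin> z} \<noteq> {}" "{z\<in>Z. i \<in> z} \<noteq> {}" using mixed by auto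
  obtain M where M: "M \<in> Z" "i \<notin> M" "\<And>X. X \<in> Z \<Longrightarrow> M \<subset> X \<Longrightarrow> i \<in> X"
    using finite_has_maximal[OF fin(1) ne(1)] by blast
  obtain W where W: "W \<in> Z" "i \<in> W" "\<And>X. X \<in> Z \<Longrightarrow> X \<subset> W \<Longrightarrow> i \<notin> X"
    using finite_has_minimal[OF fin(2) ne(2)] by blast
  have MF: "i \<in> X" if "X \<in> F" "M \<subset> X" for X
  proof (rule maximal_without_lift[OF P AB(3,4) _ _ that])
    show "M \<in> P" using M Z by blast
    show "i \<in> X" if "X \<in> P" "M \<subset> X" for X
      using that M cross[of X M] unfolding incomparable_def by blast
  qed
  have WF: "i \<notin> X" if "X \<in> F" "X \<subset> W" for X
  proof (rule minimal_with_lift[OF P AB(1,2) _ _ that])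
    show "W \<in> P" using W Z by blast
    show "i \<notin> X" if "X \<in> P" "X \<subset> W" for X
      using that W cross[of X W] unfolding incomparable_def by blast
  qed
  obtain B' where B': "critical F i M B'"
    using critical_partner_of_maximal[OF sat i _ M(2) MF] M(1) ZF by blast
  obtain A' where A': "critical F i A' W"
    using critical_partner_of_minimal[OF sat _ W(2) WF] W(1) ZF by blast
  have out: "B' \<notin> Z" "A' \<notin> Z" using notin M W A' B' unfolding labels_def by blast+
  have A'F: "A' \<in> F" "i \<notin> A'" "W \<subseteq> insert i A'" using A' unfolding critical_def by auto
  have B'F: "B' \<in> F" "i \<in> B'" "B' \<subseteq> insert i M" using B' unfolding critical_def by auto
  obtain l r where lr: "l \<in> L" "r \<in> R" using Z(3) unfolding series_def by blast
  have "M \<notin> L"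
  proof
    assume "M \<in> L"
    then have "M \<subset> r" using Z(3) lr unfolding series_def by blast
    then have "i \<in> r" using M(3) lr Z by blast
    \<comment> \<open>\<open>B'\<close> adds only \<open>i\<close> to \<open>M\<close>, and
      \<open>r\<close> contains both; autonomy then carries this relation from \<open>r\<close> down
      to \<open>M\<close>, which lacks \<open>i\<close>.\<close>
    then have "B' \<subset> r" using \<open>M \<subset> r\<close> B'F out lr Z by blast
    then have "B' \<subset> M" using autonomousD(1)[OF aZ B'F(1) out(1), of r M] lr M Z by blast
    then show False using B'F M by blast
  qed
  then have MR: "M \<in> R" using M Z by blast
  \<comment> \<open>A \<open>W\<close> in \<open>L\<close> would lie below \<open>M\<close> and put
    \<open>i\<close> into \<open>M\<close>.\<close>
  then have "W \<notin> L" using M(2) W(2) Z(3) unfolding series_def by blast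
  then have "W \<in> R" using W Z by blast
  then have "l \<subset> W" using Z(3) lr unfolding series_def by blast
  then have "i \<notin> l" using W(3) lr Z by blast
  then have "l \<subset> A'" using \<open>l \<subset> W\<close> A'F out lr Z by blast
  then have "W \<subset> A'" using autonomousD(2)[OF aZ A'F(1) out(2), of l W] lr W Z by blast
  then show False using A'F W by blast
qed

lemma labels_subset:
  assumes "N_saturated n F" "P \<subseteq> F"
  shows "labels F P \<subseteq> {1..n}"
  using assms unfolding labels_def critical_def N_saturated_def by blast

text \<open>The exchange comes from partners inside \<open>P\<close>. A partner outside
  \<open>P\<close> can spoil it for maximal elements (\<open>up_out\<close>) or for minimal ones
  (\<open>down_out\<close>), but anchoring excludes that both occur, and either direction suffices
  for the count.\<close>

lemma card_labels_parallel:
  assumes sat: "N_saturated n F" and P: "autonomous F P" "anchored F P" "P \<noteq> {}"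
    and Z: "\<Union>\<Z> = P" "\<And>Z. Z \<in> \<Z> \<Longrightarrow> card Z = 1 \<or> (\<exists>L R. Z = L \<union> R \<and> series L R)"
    and par: "\<And>Y Z. Y \<in> \<Z> \<Longrightarrow> Z \<in> \<Z> \<Longrightarrow> Y \<noteq> Z \<Longrightarrow> parallel Y Z"
  shows "card (labels F P - (\<Union>Z\<in>\<Z>. labels F Z)) + 2 \<le> 2 * card \<Z>"
proof -
  define J where "J = labels F P - (\<Union>Z\<in>\<Z>. labels F Z)"
  have finF: "finite F" using N_saturated_finite[OF sat] .
  have PF: "P \<subseteq> F" using P unfolding autonomous_def by blast
  have finP: "finite P" using PF finF finite_subset by blast
  have finZ: "finite \<Z>" using finP Z(1) finite_UnionD by blast
  have Zne: "\<Z> \<noteq> {}" using Z(1) P(3) by blast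
  have ZP: "Z \<subseteq> P" if "Z \<in> \<Z>" for Z using that Z(1) by blast
  have nonempty: "Z \<noteq> {}" if "Z \<in> \<Z>" for Z using Z(2)[OF that] unfolding series_def by auto
  have J1n: "J \<subseteq> {1..n}" using labels_subset[OF sat PF] unfolding J_def by blast
  then have finJ: "finite J" using finite_subset by blast
  have cross: "incomparable x z" if xz: "Z \<in> \<Z>" "x \<in> P - Z" "z \<in> Z" for x z Z
  proof -
    obtain Y where "Y \<in> \<Z>" "x \<in> Y" using xz(2) Z(1) by blast
    then show ?thesis using par[of Y Z] xz unfolding parallel_def by blast
  qed
  have ends: "\<exists>A\<in>P. \<exists>B\<in>P. i \<notin> A \<and> i \<in> B" if i: "i \<in> J" for i
  proof -
    have "i \<in> labels F P" using i unfolding J_def by (rule DiffD1)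
    then obtain A B where "A \<in> P" "B \<in> P" and AB: "critical F i A B"
      unfolding labels_def by auto
    moreover have "i \<notin> A" "i \<in> B" using AB by (auto simp: critical_def)
    ultimately show ?thesis by blast
  qed
  have pure: "(\<forall>z\<in>Z. i \<in> z) \<or> (\<forall>z\<in>Z. i \<notin> z)" if iZ: "i \<in> J" "Z \<in> \<Z>" for i Z
  proof (cases "card Z = 1")
    case True then show ?thesis by (auto simp: card_1_singleton_iff)
  next
    case False
    then obtain L R where LR: "Z = L \<union> R" "series L R" using Z(2)[OF iZ(2)] by blast
    obtain A B where AB: "A \<in> P" "i \<notin> A" "B \<in> P" "i \<in> B" using ends[OF iZ(1)] by blast
    show ?thesis
      using series_component_pure[OF sat _ P(1) ZP[OF iZ(2)] LR cross[OF iZ(2)] AB] iZ J1n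
      unfolding J_def by blast
  qed
  define D where "D Z = {i\<in>J. \<forall>z\<in>Z. i \<in> z}" for Z
  have D: "i \<in> D Z \<longleftrightarrow> i \<in> z" if "i \<in> J" "Z \<in> \<Z>" "z \<in> Z" for i Z z
    using pure[OF that(1,2)] that unfolding D_def by blast
  have DJ: "D Z \<subseteq> J" for Z unfolding D_def by blast
  \<comment> \<open>Apart from \<open>i\<close>, \<open>B\<close> is contained in \<open>A\<close>;
    by \<open>pure\<close>, \<open>B\<close> and \<open>A\<close> represent their whole
    components.\<close>
  have exchange: "i \<in> D Y \<and> i \<notin> D Z \<and> D Y - {i} \<subseteq> D Z"
    if "i \<in> J" "critical F i A B" "Z \<in> \<Z>" "A \<in> Z" "Y \<in> \<Z>" "B \<in> Y" for i A B Y Z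
  proof -
    have "i \<in> B" "i \<notin> A" using that unfolding critical_def by auto
    moreover have "j \<in> D Z" if "j \<in> D Y" "j \<noteq> i" for j
    proof -
      have "j \<in> J" using that DJ by blast
      then show ?thesis
        using that D[of j] critical_label_unique[OF \<open>critical F i A B\<close>, of j]
          \<open>Z \<in> \<Z>\<close> \<open>A \<in> Z\<close> \<open>Y \<in> \<Z>\<close> \<open>B \<in> Y\<close> by blast
    qed
    ultimately show ?thesis using that D by blast
  qed
  define up_out where "up_out \<longleftrightarrow> (\<exists>b\<in>F. (\<forall>p\<in>P. incomparable b p) \<and> (\<forall>X\<in>F. (\<forall>p\<in>P. p \<subset> X) \<longrightarrow> b \<subseteq> X))"
  define down_out where "down_out \<longleftrightarrow> (\<exists>a\<in>F. (\<forall>p\<in>P. incomparable a p) \<and> (\<forall>X\<in>F. (\<forall>p\<in>P. X \<subset> p) \<longrightarrow> X \<subseteq> a))"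
  have maxi: "(\<exists>Y\<in>\<Z>. i \<in> D Y \<and> D Y - {i} \<subseteq> D Z) \<or> up_out"
    if i: "i \<in> J" and Zi: "Z \<in> \<Z>" "i \<notin> D Z" for i Z
  proof -
    have "finite Z" using ZP[OF Zi(1)] finP finite_subset by blast
    \<comment> \<open>All of \<open>Z\<close> avoids \<open>i\<close>, so any maximal element of
      \<open>Z\<close> is maximal without \<open>i\<close> in \<open>P\<close>.\<close>
    then obtain M where M: "M \<in> Z" "\<And>X. X \<in> Z \<Longrightarrow> \<not> M \<subset> X"
      using finite_has_maximal[OF _ nonempty[OF Zi(1)]] by blast
    have iM: "i \<notin> M" using D[OF i Zi(1) M(1)] Zi by blast
    have MP: "M \<in> P" using M ZP[OF Zi(1)] by blast
    obtain B where B: "B \<in> P" "i \<in> B" using ends[OF i] by blast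
    have MF: "i \<in> X" if "X \<in> F" "M \<subset> X" for X
    proof (rule maximal_without_lift[OF P(1) B MP _ that])
      show "i \<in> X" if "X \<in> P" "M \<subset> X" for X
        using that M cross[OF Zi(1), of X M] unfolding incomparable_def by blast
    qed
    obtain b where b: "critical F i M b"
      using critical_partner_of_maximal[OF sat _ _ iM MF] i J1n MP PF by blast
    have bF: "b \<in> F" "i \<in> b" "b \<subseteq> insert i M" "\<And>X. X \<in> F \<Longrightarrow> X \<subset> b \<Longrightarrow> i \<notin> X"
      using b unfolding critical_def by auto
    show ?thesis
    proof (cases "b \<in> P")
      case True
      then obtain Y where "Y \<in> \<Z>" "b \<in> Y" using Z(1) by blast
      then show ?thesis using exchange[OF i b Zi(1) M(1)] by blast
    next
      case False
      \<comment> \<open>Otherwise \<open>b\<close> would be above all of \<open>P\<close>, and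
        \<open>B\<close> below \<open>b\<close> would contradict the minimality of
        \<open>b\<close>.\<close>
      have "\<not> M \<subset> b"
        using autonomousD(2)[OF P(1) bF(1) False MP _ B(1)] bF(4)[of B] B PF by blast
      then have "incomparable b M" using bF iM False MP unfolding incomparable_def by blast
      then have "\<forall>p\<in>P. incomparable b p" using autonomousD(3)[OF P(1) bF(1) False MP] by blast
      moreover have "b \<subseteq> X" if "X \<in> F" "\<forall>p\<in>P. p \<subset> X" for X
        using MF[OF that(1)] that(2) MP bF(3) by blast
      ultimately show ?thesis unfolding up_out_def using bF(1) by blast
    qed
  qed
  have mini: "(\<exists>Z\<in>\<Z>. i \<notin> D Z \<and> D Y - {i} \<subseteq> D Z) \<or> down_out"
    if i: "i \<in> J" and Yi: "Y \<in> \<Z>" "i \<in> D Y" for i Y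
  proof -
    have "finite Y" using ZP[OF Yi(1)] finP finite_subset by blast
    then obtain W where W: "W \<in> Y" "\<And>X. X \<in> Y \<Longrightarrow> \<not> X \<subset> W"
      using finite_has_minimal[OF _ nonempty[OF Yi(1)]] by blast
    have iW: "i \<in> W" using D[OF i Yi(1) W(1)] Yi by blast
    have WP: "W \<in> P" using W ZP[OF Yi(1)] by blast
    obtain A where A: "A \<in> P" "i \<notin> A" using ends[OF i] by blast
    have WF: "i \<notin> X" if "X \<in> F" "X \<subset> W" for X
    proof (rule minimal_with_lift[OF P(1) A WP _ that])
      show "i \<notin> X" if "X \<in> P" "X \<subset> W" for X
        using that W cross[OF Yi(1), of X W] unfolding incomparable_def by blast
    qed
    obtain a where a: "critical F i a W"
      using critical_partner_of_minimal[OF sat _ iW WF] WP PF by blast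
    have aF: "a \<in> F" "i \<notin> a" "W \<subseteq> insert i a" "\<And>X. X \<in> F \<Longrightarrow> a \<subset> X \<Longrightarrow> i \<in> X"
      using a unfolding critical_def by auto
    show ?thesis
    proof (cases "a \<in> P")
      case True
      then obtain Z where "Z \<in> \<Z>" "a \<in> Z" using Z(1) by blast
      then show ?thesis using exchange[OF i a _ _ Yi(1) W(1)] by blast
    next
      case False
      have "\<not> a \<subset> W"
        using autonomousD(1)[OF P(1) aF(1) False WP _ A(1)] aF(4)[of A] A PF by blast
      then have "incomparable a W" using aF iW False WP unfolding incomparable_def by blast
      then have "\<forall>p\<in>P. incomparable a p" using autonomousD(3)[OF P(1) aF(1) False WP] by blast
      moreover have "X \<subseteq> a" if "X \<in> F" "\<forall>p\<in>P. X \<subset> p" for X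
        using WF[OF that(1)] that(2) WP aF(3) by blast
      ultimately show ?thesis unfolding down_out_def using aF(1) by blast
    qed
  qed
  have "\<not> up_out \<or> \<not> down_out"
  proof (rule ccontr)
    assume "\<not> (\<not> up_out \<or> \<not> down_out)"
    then have out: up_out down_out by auto
    from out(1) obtain b where b: "b \<in> F" "\<forall>p\<in>P. incomparable b p"
        "\<forall>X\<in>F. (\<forall>p\<in>P. p \<subset> X) \<longrightarrow> b \<subseteq> X" unfolding up_out_def by blast
    from out(2) obtain a where a: "a \<in> F" "\<forall>p\<in>P. incomparable a p"
        "\<forall>X\<in>F. (\<forall>p\<in>P. X \<subset> p) \<longrightarrow> X \<subseteq> a" unfolding down_out_def by blast
    \<comment> \<open>An anchor above \<open>P\<close> contains \<open>b\<close>, and one below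
      \<open>P\<close> is contained in \<open>a\<close>; both contradict incomparability.\<close>
    obtain z where "z \<in> F" "(\<forall>p\<in>P. z \<subset> p) \<or> (\<forall>p\<in>P. p \<subset> z)"
      "incomparable z a" "incomparable z b"
      using P(2)[unfolded anchored_def, rule_format, OF a(1) b(1)] a(2) b(2) by blast
    then show False using a(3) b(3) unfolding incomparable_def by metis
  qed
  then have "card J + 2 \<le> 2 * card \<Z>"
  proof
    assume "\<not> up_out"
    then have up: "\<exists>Y\<in>\<Z>. i \<in> D Y \<and> D Y - {i} \<subseteq> D Z" if "i \<in> J" "Z \<in> \<Z>" "i \<notin> D Z" for i Z
      using maxi[OF that] by blast
    \<comment> \<open>Partners of maximal elements give the exchange in the reverse direction, which
      is the required one for the complements \<open>J - D Z\<close>.\<close>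
    show ?thesis
    proof (rule card_exchange_family_le[OF finZ Zne finJ, of "\<lambda>Z. J - D Z"])
      show "\<exists>Z\<in>\<Z>. i \<in> J - D Z" if i: "i \<in> J" for i
      proof -
        obtain A where A: "A \<in> P" "i \<notin> A" using ends[OF i] by blast
        then obtain Z where "Z \<in> \<Z>" "A \<in> Z" using Z(1) by blast
        then show ?thesis using D[OF i] A i by blast
      qed
      show "\<exists>X\<in>\<Z>. i \<notin> J - D X \<and> J - D Y - {i} \<subseteq> J - D X" if "Y \<in> \<Z>" "i \<in> J - D Y" for Y i
        using up[of i Y] that by blast
    qed blast
  next
    assume "\<not> down_out"
    then have down: "\<exists>Z\<in>\<Z>. i \<notin> D Z \<and> D Y - {i} \<subseteq> D Z" if "i \<in> J" "Y \<in> \<Z>" "i \<in> D Y" for i Y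
      using mini[OF that] by blast
    show ?thesis
    proof (rule card_exchange_family_le[OF finZ Zne finJ, of D])
      show "\<exists>Z\<in>\<Z>. i \<in> D Z" if i: "i \<in> J" for i
      proof -
        obtain B where B: "B \<in> P" "i \<in> B" using ends[OF i] by blast
        then obtain Z where "Z \<in> \<Z>" "B \<in> Z" using Z(1) by blast
        then show ?thesis using D[OF i] B i by blast
      qed
    qed (use DJ down in blast)+
  qed
  then show ?thesis unfolding J_def .
qed

text \<open>A label of a crossing pair is contained in every member of \<open>R\<close> and in no
  member of \<open>L\<close>. Two such labels would both lie in \<open>B - A\<close> for one
  critical pair, which has a single element.\<close>

lemma card_labels_series:
  assumes fin: "finite (labels F L)" "finite (labels F R)" and s: "series L R" "L \<union> R \<subseteq> F"
  shows "card (labels F (L \<union> R)) \<le> card (labels F L) + card (labels F R) + 1"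
proof -
  define C where "C = {i. \<exists>A\<in>L. \<exists>B\<in>R. critical F i A B}"
  have C: "(\<forall>l\<in>L. i \<notin> l) \<and> (\<forall>r\<in>R. i \<in> r)" if i: "i \<in> C" for i
  proof -
    obtain A B where AB: "A \<in> L" "B \<in> R" "critical F i A B" using i unfolding C_def by blast
    have ex: "\<And>X. X \<in> F \<Longrightarrow> A \<subset> X \<Longrightarrow> i \<in> X" "\<And>X. X \<in> F \<Longrightarrow> X \<subset> B \<Longrightarrow> i \<notin> X"
      using AB(3) unfolding critical_def by blast+
    have "i \<notin> l" if "l \<in> L" for l using ex(2)[of l] AB that s unfolding series_def by blast
    moreover have "i \<in> r" if "r \<in> R" for r using ex(1)[of r] AB that s unfolding series_def by blast
    ultimately show ?thesis by blast
  qed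
  have uniq: "i = j" if ij: "i \<in> C" "j \<in> C" for i j
  proof -
    obtain A B where "A \<in> L" "B \<in> R" "critical F i A B" using ij(1) unfolding C_def by blast
    then show ?thesis using C[OF ij(2)] critical_label_unique by metis
  qed
  have "finite C \<and> card C \<le> 1"
  proof (cases "C = {}")
    case False
    then obtain i where "i \<in> C" by blast
    then have "C = {i}" using uniq by blast
    then show ?thesis by simp
  qed simp
  moreover have "\<not> critical F i A B" if "A \<in> R" "B \<in> L" for i A B
    using that s(1) unfolding critical_def series_def by blast
  then have "labels F (L \<union> R) \<subseteq> labels F L \<union> labels F R \<union> C"
    unfolding labels_def C_def by blast
  ultimately have "card (labels F (L \<union> R)) \<le> card (labels F L \<union> labels F R \<union> C)"
    using fin by (intro card_mono) auto
  also have "\<dots> \<le> card (labels F L) + card (labels F R) + card C"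
    using card_Un_le[of "labels F L \<union> labels F R" C] card_Un_le[of "labels F L" "labels F R"]
    by linarith
  finally show ?thesis using \<open>finite C \<and> card C \<le> 1\<close> by linarith
qed

text \<open>Anchoring is passed on to the two sides of a series split; components of a parallel node
  enter instead as singletons or series, hence the disjunction. A series split even saves one, and a
  parallel node with k components adds 2k - 2 to the sum of the 2|Z| - 2.\<close>

lemma card_labels_le:
  assumes sat: "N_saturated n F"
    and "autonomous F P" "P \<noteq> {}"
    and "anchored F P \<or> card P = 1 \<or> (\<exists>L R. P = L \<union> R \<and> series L R)"
  shows "card (labels F P) + 2 \<le> 2 * card P"
  using assms(2-)
proof (induction "card P" arbitrary: P rule: less_induct)
  case less
  have finF: "finite F" using N_saturated_finite[OF sat] .
  have PF: "P \<subseteq> F" using less.prems unfolding autonomous_def by blast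
  have finP: "finite P" using PF finF finite_subset by blast
  have finlab: "finite (labels F Q)" if "Q \<subseteq> F" for Q
    using labels_subset[OF sat that] finite_subset by blast
  consider (one) "card P = 1" | (ser) L R where "P = L \<union> R" "series L R"
    | (anc) "anchored F P" "card P \<noteq> 1" "\<not> (\<exists>L R. P = L \<union> R \<and> series L R)"
    using less.prems(3) by blast
  then show ?case
  proof cases
    case one
    then obtain x where "P = {x}" by (auto simp: card_1_singleton_iff)
    then have "labels F P = {}" unfolding labels_def critical_def by blast
    then show ?thesis using one by simp
  next
    case ser
    have disj: "L \<inter> R = {}" "L \<noteq> {}" "R \<noteq> {}" using ser(2) unfolding series_def by blast+
    have fin: "finite L" "finite R" using finP ser by auto
    have card: "card P = card L + card R" using ser disj fin card_Un_disjoint by blast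
    have pos: "card L > 0" "card R > 0" using disj fin by (auto simp: card_gt_0_iff)
    have aut: "autonomous F L" "autonomous F R" "anchored F L" "anchored F R"
      using autonomous_series anchored_series less.prems(1) ser by blast+
    have "card (labels F L) + 2 \<le> 2 * card L" "card (labels F R) + 2 \<le> 2 * card R"
      using less.hyps[of L] less.hyps[of R] aut disj card pos by auto
    moreover have "card (labels F P) \<le> card (labels F L) + card (labels F R) + 1"
      using card_labels_series[of F L R] ser PF finlab by auto
    ultimately show ?thesis using card by linarith
  next
    case anc
    have free: "\<not> contains_induced_N P"
      using sat contains_induced_N_mono PF unfolding N_saturated_def by blast
    obtain \<Z> where Z: "\<Union>\<Z> = P" "\<forall>Z\<in>\<Z>. card Z = 1 \<or> (\<exists>L R. Z = L \<union> R \<and> series L R)"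
      and par: "\<forall>Y\<in>\<Z>. \<forall>Z\<in>\<Z>. Y \<noteq> Z \<longrightarrow> parallel Y Z"
      using N_free_components[OF finP free less.prems(2)] by blast
    have finZ: "finite \<Z>" using finP Z(1) finite_UnionD by blast
    have finZ': "finite Z" if "Z \<in> \<Z>" for Z using that finP Z(1) by (metis Sup_upper finite_subset)
    have bound: "card (labels F Z) + 2 \<le> 2 * card Z" if "Z \<in> \<Z>" for Z
    proof (rule less.hyps)
      \<comment> \<open>\<open>Z\<close> is a singleton or series, while \<open>P\<close> in this
        case is neither.\<close>
      have "Z \<subseteq> P" "Z \<noteq> P" using that Z anc by auto
      then show "card Z < card P" using finP by (simp add: psubset_card_mono psubsetI)
      show "autonomous F Z"
      proof (rule autonomous_component[OF less.prems(1) \<open>Z \<subseteq> P\<close>])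
        fix x z assume xz: "x \<in> P - Z" "z \<in> Z"
        then obtain Y where "Y \<in> \<Z>" "x \<in> Y" using Z(1) by blast
        then show "incomparable x z" using par that xz unfolding parallel_def by blast
      qed
      show "Z \<noteq> {}" using that Z(2) unfolding series_def by fastforce
      show "anchored F Z \<or> card Z = 1 \<or> (\<exists>L R. Z = L \<union> R \<and> series L R)" using that Z(2) by blast
    qed
    have "\<forall>Y\<in>\<Z>. \<forall>Z\<in>\<Z>. Y \<noteq> Z \<longrightarrow> Y \<inter> Z = {}"
      using par unfolding parallel_def incomparable_def by blast
    then have cardP: "card P = (\<Sum>Z\<in>\<Z>. card Z)"
      using card_Union_disjoint[of \<Z>] finZ' Z(1) by (auto simp: pairwise_def disjnt_def)
    have cross: "card (labels F P - (\<Union>Z\<in>\<Z>. labels F Z)) + 2 \<le> 2 * card \<Z>"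
      using card_labels_parallel[OF sat less.prems(1) anc(1) less.prems(2) Z(1)] Z(2) par by blast
    have "labels F P \<subseteq> (labels F P - (\<Union>Z\<in>\<Z>. labels F Z)) \<union> (\<Union>Z\<in>\<Z>. labels F Z)" by blast
    moreover have "finite (labels F Z)" if "Z \<in> \<Z>" for Z using that Z(1) PF finlab by blast
    ultimately have "card (labels F P) \<le>
        card ((labels F P - (\<Union>Z\<in>\<Z>. labels F Z)) \<union> (\<Union>Z\<in>\<Z>. labels F Z))"
      using finZ finlab[OF PF] by (intro card_mono) auto
    also have "\<dots> \<le> card (labels F P - (\<Union>Z\<in>\<Z>. labels F Z)) + card (\<Union>Z\<in>\<Z>. labels F Z)"
      by (rule card_Un_le)
    also have "card (\<Union>Z\<in>\<Z>. labels F Z) \<le> (\<Sum>Z\<in>\<Z>. card (labels F Z))"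
      using finZ by (rule card_UN_le)
    finally have le: "card (labels F P) \<le> card (labels F P - (\<Union>Z\<in>\<Z>. labels F Z))
        + (\<Sum>Z\<in>\<Z>. card (labels F Z))" by simp
    have "(\<Sum>Z\<in>\<Z>. card (labels F Z) + 2) \<le> (\<Sum>Z\<in>\<Z>. 2 * card Z)"
      by (rule sum_mono) (rule bound)
    then have "(\<Sum>Z\<in>\<Z>. card (labels F Z)) + 2 * card \<Z> \<le> 2 * card P"
      by (simp add: sum.distrib cardP sum_distrib_left del: add_2_eq_Suc')
    then show ?thesis using le cross by linarith
  qed
qed

section \<open>All ground elements are labels; the final bound\<close>

lemma N_saturated_empty_mem:
  assumes "N_saturated n F"
  shows "{} \<in> F"
proof (rule ccontr)
  assume "{} \<notin> F"
  then have "contains_induced_N (insert {} F)" "\<not> contains_induced_N F"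
    using assms unfolding N_saturated_def by auto
  \<comment> \<open>The empty set is comparable to everything, but every element of N is
    incomparable to some other, so the copy avoids it.\<close>
  then show False
    unfolding contains_induced_N_def incomparable_def by blast
qed

text \<open>The empty set avoids \<open>i\<close>, so there is a maximal member without
  \<open>i\<close>, and its partner makes \<open>i\<close> a label.\<close>

lemma N_saturated_labels:
  assumes sat: "N_saturated n F"
  shows "labels F F = {1..n}"
proof
  show "labels F F \<subseteq> {1..n}" by (rule labels_subset[OF sat order_refl])
  show "{1..n} \<subseteq> labels F F"
  proof
    fix i assume i: "i \<in> {1..n}"
    have fin: "finite {X\<in>F. i \<notin> X}" using N_saturated_finite[OF sat] by simp
    have ne: "{X\<in>F. i \<notin> X} \<noteq> {}" using N_saturated_empty_mem[OF sat] by blast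
    obtain A where "A \<in> F" "i \<notin> A" "\<And>X. X \<in> F \<Longrightarrow> A \<subset> X \<Longrightarrow> i \<in> X"
      using finite_has_maximal[OF fin ne] by blast
    then obtain B where "critical F i A B" using critical_partner_of_maximal[OF sat i] by blast
    then show "i \<in> labels F F" unfolding labels_def critical_def by blast
  qed
qed

theorem theorem4p2:
  fixes n :: nat and F :: "nat set set"
  assumes "n \<ge> 1" and "N_saturated n F"
  shows "real (card F) \<ge> (real n + 6) / 4"
proof -
  have "F \<noteq> {}" using N_saturated_empty_mem[OF assms(2)] by blast
  moreover have "autonomous F F" unfolding autonomous_def by blast
  \<comment> \<open>Vacuous: no member of \<open>F\<close> is incomparable to itself.\<close>
  moreover have "anchored F F" unfolding anchored_def incomparable_def by blast
  ultimately have "n + 2 \<le> 2 * card F"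
    using card_labels_le[OF assms(2), of F] N_saturated_labels[OF assms(2)] by simp
  \<comment> \<open>Doubling gives 2n + 4, at least n + 6 once n is at least 2; for n = 1,
    integrality gives \<open>card F \<ge> 2\<close>.\<close>
  then have "n + 6 \<le> 4 * card F" using assms(1) by presburger
  then have "real (n + 6) \<le> real (4 * card F)" by (rule of_nat_mono)
  then show ?thesis by simp
qed

end
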